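(* Let $Z$ be a Hausdorff topological vector space and let $X$ be a nonempty compact convex subset of a topological vector space $E$. Let $C\subset Z$ be a pointed closed convex cone with nonempty interior and let $K:X\rightrightarrows X$ and $f:X\times X\rightrightarrows Z$ be correspondences with nonempty values. Let $A=\{x\in X:\text{ there exists }u\in K(x)\text{ such that }f(x,u)\subseteq -\operatorname{int}C\}$. Assume that: (i) $K$ is open valued and for each $x\in X$, the set $\{u\in X: f(x,u)\subseteq -\operatorname{int}C\}$ is open; (ii) $f(x,x)\nsubseteq -\operatorname{int}C$ for each $x\in X$; (iii) there exists $M\in\langle X\rangle$ such that $$\bigcup_{x\in M\cap A}\bigl[\{u\in X: f(x,u)\subseteq -\operatorname{int}C\}\cap K(x)\bigr]\ \cup\ \bigcup_{x\in M\setminus A}K(x)=X;$$ (iv) $K^{-1}:X\rightrightarrows X$ is convex valued and for each $u\in X$, the set $\{x\in X: f(x,u)\subseteq -\operatorname{int}C\}\cup(X\setminus A)$ is convex. Then there exists $x^{*}\in X$ such that $x^{*}\in K(x^{*})$ and $f(x^{*},y)\nsubseteq -\operatorname{int}C$ for each $y\in K(x^{*})$.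
   Context: A correspondence $T:X\rightrightarrows Y$ is a set-valued map assigning to each $x\in X$ a subset $T(x)\subseteq Y$. $K^{-1}(u)=\{x\in X: u\in K(x)\}$. $\langle X\rangle$ denotes the class of all nonempty finite subsets of $X$. Openness of subsets of $X$ is in the subspace topology of $X$; $\operatorname{int}C$ is the interior of $C$ in $Z$. *)

theory Defs
  imports "HOL-Analysis.Analysis"
begin

text \<open>
  Real topological vector spaces. Joint continuity of scalar multiplication is written
  with neighbourhood filters, in the style of \<^class>\<open>topological_monoid_add\<close>.
  No separation axiom is included; a Hausdorff space is obtained by adding \<^class>\<open>t2_space\<close>.
\<close>

class real_topological_vector = real_vector + topological_ab_group_add +
  assumes tendsto_scaleR_Pair:
    "LIM x (nhds c \<times>\<^sub>F nhds a). fst x *\<^sub>R snd x :> nhds (c *\<^sub>R a)"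

instance real_normed_vector \<subseteq> real_topological_vector
proof
  fix c :: real and a :: 'a
  show "LIM x (nhds c \<times>\<^sub>F nhds a). fst x *\<^sub>R snd x :> nhds (c *\<^sub>R a)"
    by (intro tendsto_scaleR filterlim_fst filterlim_snd)
qed

text \<open>
  \<^const>\<open>cone\<close> asks for closure under multiplication by all scalars \<open>c \<ge> 0\<close>.
\<close>

definition pointed_cone :: "'a::real_vector set \<Rightarrow> bool"
  where "pointed_cone C \<longleftrightarrow> cone C \<and> C \<inter> uminus ` C = {0}"

text \<open>
  A correspondence on \<open>X\<close> is a set-valued function of which only the values at points of
  \<open>X\<close> are relevant, so the values of the inverse are cut down to \<open>X\<close>.
\<close>

definition inverse_corr :: "'a set \<Rightarrow> ('a \<Rightarrow> 'b set) \<Rightarrow> 'b \<Rightarrow> 'a set"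
  where "inverse_corr X K u = {x \<in> X. u \<in> K x}"

end

theory Submission
  imports Defs
begin

text \<open>
  Put \<open>F x = K x\<close> for \<open>x \<notin> A\<close> and
  \<open>F x = {u \<in> X. f x u \<subseteq> - int C} \<inter> K x\<close> for \<open>x \<in> A\<close>. It suffices to find \<open>u \<in> F u\<close>: such
  a \<open>u\<close> cannot lie in \<open>A\<close>, because then \<open>f u u \<subseteq> - int C\<close>; hence \<open>u \<in> K u\<close>, and \<open>u \<notin> A\<close> is the
  second half of the conclusion. The hypotheses say that the values of \<open>F\<close> are open in \<open>X\<close>, that
  finitely many of them, \<open>F (h 0), \<dots>, F (h (n - 1))\<close>, cover \<open>X\<close>, and that the sets
  \<open>{x \<in> X. u \<in> F x} = K\<^sup>-\<^sup>1 u \<inter> ({x \<in> X. f x u \<subseteq> - int C} \<union> (X - A))\<close> are convex.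

  Such a correspondence has a fixed point (\<open>fixed_point_finite_cover\<close>). The space is not
  assumed Hausdorff, so \<open>X\<close> itself need not carry a partition of unity. Instead the cover is
  pulled back along a continuous map \<open>\<phi>\<close> from the cube \<open>[0,1]\<^sup>n\<close> into \<open>X\<close> which is
  \<open>t \<mapsto> (\<Sum>i<n. t i *\<^sub>R h i)\<close> on the standard simplex. A partition of unity \<open>w\<close> subordinate to
  the pulled back cover is a continuous map of the cube into that simplex, so Brouwer's theorem
  (\<open>brouwer_unit_cube\<close>) gives a point \<open>t\<close> of the simplex with \<open>w t = t\<close>. Then \<open>\<phi> t\<close> is a
  convex combination of those \<open>h i\<close> with \<open>\<phi> t \<in> F (h i)\<close>, and convexity yields
  \<open>\<phi> t \<in> F (\<phi> t)\<close>.
\<close>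

section \<open>Brouwer's fixed point theorem for cubes of arbitrary dimension\<close>

text \<open>
  The cube \<open>[0,1]\<^sup>n\<close> in \<open>nat \<Rightarrow> real\<close>, with all coordinates from \<open>n\<close> on equal to \<open>0\<close>. The
  dimension is a number and not a type, since it will be the size of a finite set obtained within
  a proof. The topology is that of coordinatewise convergence.
\<close>

definition unit_cube :: "nat \<Rightarrow> (nat \<Rightarrow> real) set"
  where "unit_cube n = {t. (\<forall>i<n. 0 \<le> t i \<and> t i \<le> 1) \<and> (\<forall>i\<ge>n. t i = 0)}"

lemma compact_unit_cube: "compact (unit_cube n)"
proof -
  have eq: "unit_cube n = PiE UNIV (\<lambda>i. if i < n then {0..1} else {0})"
    by (auto simp: unit_cube_def PiE_def Pi_def not_le[symmetric] split: if_splits)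
  have "compactin (product_topology (\<lambda>_. euclidean) UNIV)
      (PiE UNIV (\<lambda>i::nat. if i < n then {0..1::real} else {0}))"
    by (subst compactin_PiE) auto
  then show ?thesis
    by (simp add: eq euclidean_product_topology flip: compactin_euclidean_iff)
qed

lemma tendsto_coordinatewise:
  fixes g :: "'a \<Rightarrow> 'b \<Rightarrow> 'c::topological_space"
  shows "(g \<longlongrightarrow> l) F \<longleftrightarrow> (\<forall>i. ((\<lambda>x. g x i) \<longlongrightarrow> l i) F)"
  using limitin_componentwise[of "\<lambda>_. euclidean" UNIV g l F]
  by (simp add: euclidean_product_topology)

text \<open>
  Kuhn's lemma on the grid of mesh \<open>1 / p\<close>, the grid points being labelled by the sign of
  \<open>f x i - x i\<close>: in some cell every coordinate of \<open>f x - x\<close> is nonnegative at one vertex and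
  nonpositive at another.
\<close>

lemma unit_cube_approximate_fixed_point:
  fixes f :: "(nat \<Rightarrow> real) \<Rightarrow> nat \<Rightarrow> real"
  assumes f: "f ` unit_cube n \<subseteq> unit_cube n" and p: "0 < p"
  shows "\<exists>q \<in> unit_cube n. \<forall>i<n. \<exists>a \<in> unit_cube n. \<exists>b \<in> unit_cube n.
    (\<forall>j. \<bar>a j - q j\<bar> \<le> 1 / real p) \<and> (\<forall>j. \<bar>b j - q j\<bar> \<le> 1 / real p) \<and>
    a i \<le> f a i \<and> f b i \<le> b i"
proof -
  have maps: "\<forall>x. x \<in> unit_cube n \<longrightarrow> f x \<in> unit_cube n"
    using f by blast
  have bounds: "\<forall>x. x \<in> unit_cube n \<longrightarrow> (\<forall>i. i < n \<longrightarrow> 0 \<le> x i \<and> x i \<le> 1)"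
    by (simp add: unit_cube_def)
  obtain l :: "(nat \<Rightarrow> real) \<Rightarrow> nat \<Rightarrow> nat" where labels:
    "\<forall>x i. l x i \<le> 1"
    "\<forall>x i. x \<in> unit_cube n \<and> i < n \<and> x i = 0 \<longrightarrow> l x i = 0"
    "\<forall>x i. x \<in> unit_cube n \<and> i < n \<and> x i = 1 \<longrightarrow> l x i = 1"
    "\<forall>x i. x \<in> unit_cube n \<and> i < n \<and> l x i = 0 \<longrightarrow> x i \<le> f x i"
    "\<forall>x i. x \<in> unit_cube n \<and> i < n \<and> l x i = 1 \<longrightarrow> f x i \<le> x i"
    using kuhn_labelling_lemma'[OF maps bounds] by (elim exE conjE) (rule that; assumption)
  have l: "l x i \<le> 1"
    "x \<in> unit_cube n \<Longrightarrow> i < n \<Longrightarrow> x i = 0 \<Longrightarrow> l x i = 0"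
    "x \<in> unit_cube n \<Longrightarrow> i < n \<Longrightarrow> x i = 1 \<Longrightarrow> l x i = 1"
    "x \<in> unit_cube n \<Longrightarrow> i < n \<Longrightarrow> l x i = 0 \<Longrightarrow> x i \<le> f x i"
    "x \<in> unit_cube n \<Longrightarrow> i < n \<Longrightarrow> l x i = 1 \<Longrightarrow> f x i \<le> x i" for x i
    using labels by blast+
  define e :: "(nat \<Rightarrow> nat) \<Rightarrow> nat \<Rightarrow> real"
    where "e z = (\<lambda>i. if i < n then real (z i) / real p else 0)" for z
  have e_cube: "e z \<in> unit_cube n" if "\<And>i. i < n \<Longrightarrow> z i \<le> p" for z
    using that p by (auto simp: e_def unit_cube_def)
  have e_near: "\<bar>e r j - e q j\<bar> \<le> 1 / real p"
    if "\<forall>j<n. q j \<le> r j \<and> r j \<le> q j + 1" for q r j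
  proof (cases "j < n")
    case True
    then have "\<bar>real (r j) - real (q j)\<bar> \<le> 1"
      using that by force
    then show ?thesis
      using True p by (simp add: e_def divide_right_mono flip: diff_divide_distrib)
  qed (simp add: e_def)
  obtain q where q: "\<forall>i<n. q i < p"
    and cell: "\<forall>i<n. \<exists>r s. (\<forall>j<n. q j \<le> r j \<and> r j \<le> q j + 1) \<and>
      (\<forall>j<n. q j \<le> s j \<and> s j \<le> q j + 1) \<and> l (e r) i \<noteq> l (e s) i"
  proof (rule kuhn_lemma[OF p, of n "\<lambda>z. l (e z)"])
    show "\<forall>x. (\<forall>i<n. x i \<le> p) \<longrightarrow> (\<forall>i<n. l (e x) i = 0 \<or> l (e x) i = 1)"
      using l(1) by (metis One_nat_def le_Suc_eq le_zero_eq)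
    show "\<forall>x. (\<forall>i<n. x i \<le> p) \<longrightarrow> (\<forall>i<n. x i = 0 \<longrightarrow> l (e x) i = 0)"
      using l(2) e_cube by (simp add: e_def)
    show "\<forall>x. (\<forall>i<n. x i \<le> p) \<longrightarrow> (\<forall>i<n. x i = p \<longrightarrow> l (e x) i = 1)"
      using l(3) e_cube p by (simp add: e_def)
  qed
  show ?thesis
  proof (rule bexI[of _ "e q"], intro allI impI)
    show "e q \<in> unit_cube n"
      using q by (intro e_cube) (simp add: less_imp_le)
    fix i assume i: "i < n"
    obtain r s where r: "\<forall>j<n. q j \<le> r j \<and> r j \<le> q j + 1"
      and s: "\<forall>j<n. q j \<le> s j \<and> s j \<le> q j + 1" and rs: "l (e r) i \<noteq> l (e s) i"
      using cell i by blast
    have cube: "e r \<in> unit_cube n" "e s \<in> unit_cube n"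
      using q r s by (auto intro!: e_cube simp: Suc_le_eq dest: le_less_trans) (meson Suc_leI le_trans)+
    consider "l (e r) i = 0" "l (e s) i = 1" | "l (e r) i = 1" "l (e s) i = 0"
      using rs l(1)[of "e r" i] l(1)[of "e s" i] by linarith
    then show "\<exists>a \<in> unit_cube n. \<exists>b \<in> unit_cube n.
        (\<forall>j. \<bar>a j - e q j\<bar> \<le> 1 / real p) \<and> (\<forall>j. \<bar>b j - e q j\<bar> \<le> 1 / real p) \<and>
        a i \<le> f a i \<and> f b i \<le> b i"
    proof cases
      case 1
      then show ?thesis
        using cube l(4,5) i e_near[OF r] e_near[OF s] by blast
    next
      case 2
      then show ?thesis
        using cube l(4,5) i e_near[OF r] e_near[OF s] by blast
    qed
  qed
qed

text \<open>
  As the mesh tends to \<open>0\<close>, the cells accumulate at a point at which, by continuity, every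
  coordinate of \<open>f x - x\<close> is both nonnegative and nonpositive.
\<close>

theorem brouwer_unit_cube:
  fixes f :: "(nat \<Rightarrow> real) \<Rightarrow> nat \<Rightarrow> real"
  assumes cont: "continuous_on (unit_cube n) f" and f: "f ` unit_cube n \<subseteq> unit_cube n"
  shows "\<exists>t \<in> unit_cube n. f t = t"
proof -
  \<comment> \<open>\<open>a\<close> and \<open>b\<close> witness the two signs in coordinate \<open>i\<close> within \<open>1 / (k + 1)\<close> of \<open>x\<close>.\<close>
  define N where "N k i x a b \<longleftrightarrow> a \<in> unit_cube n \<and> b \<in> unit_cube n \<and>
      (\<forall>j. \<bar>a j - x j\<bar> \<le> 1 / real (Suc k)) \<and> (\<forall>j. \<bar>b j - x j\<bar> \<le> 1 / real (Suc k)) \<and>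
      a i \<le> f a i \<and> f b i \<le> b i" for k i and x a b :: "nat \<Rightarrow> real"
  have "\<exists>x \<in> unit_cube n. \<forall>i<n. \<exists>a b. N k i x a b" for k
    using unit_cube_approximate_fixed_point[OF f, of "Suc k"] unfolding N_def by blast
  then obtain q where q: "\<And>k. q k \<in> unit_cube n"
    and "\<And>k i. i < n \<Longrightarrow> \<exists>a b. N k i (q k) a b"
    by metis
  then have "\<forall>k i. \<exists>c. i < n \<longrightarrow> N k i (q k) (fst c) (snd c)"
    by simp
  then obtain c where N: "\<And>k i. i < n \<Longrightarrow> N k i (q k) (fst (c k i)) (snd (c k i))"
    unfolding choice_iff by blast
  define a b where "a k i = fst (c k i)" and "b k i = snd (c k i)" for k i
  have ab: "a k i \<in> unit_cube n" "b k i \<in> unit_cube n"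
    and near: "\<bar>a k i j - q k j\<bar> \<le> 1 / real (Suc k)" "\<bar>b k i j - q k j\<bar> \<le> 1 / real (Suc k)"
    and sgn: "a k i i \<le> f (a k i) i" "f (b k i) i \<le> b k i i" if "i < n" for k i j
    using N[OF that, of k] by (auto simp: N_def a_def b_def)
  obtain t r where t: "t \<in> unit_cube n" and r: "strict_mono (r :: nat \<Rightarrow> nat)"
    and lim: "(q \<circ> r) \<longlonglongrightarrow> t"
    using seq_compactE[OF compact_imp_seq_compact[OF compact_unit_cube]] q by metis
  have near_lim: "(\<lambda>k. c (r k)) \<longlonglongrightarrow> t"
    if c: "\<And>k j. \<bar>c k j - q k j\<bar> \<le> 1 / real (Suc k)" for c :: "nat \<Rightarrow> nat \<Rightarrow> real"
  proof -
    have "(\<lambda>k. c (r k) j) \<longlonglongrightarrow> t j" for j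
    proof -
      have "(\<lambda>k. c k j - q k j) \<longlonglongrightarrow> 0"
        using c by (intro Lim_null_comparison[OF _ LIMSEQ_inverse_real_of_nat])
          (simp add: inverse_eq_divide)
      then have "(\<lambda>k. c (r k) j - q (r k) j) \<longlonglongrightarrow> 0"
        using LIMSEQ_subseq_LIMSEQ[OF _ r] by (force simp: o_def)
      moreover have "(\<lambda>k. q (r k) j) \<longlonglongrightarrow> t j"
        using lim by (simp add: tendsto_coordinatewise o_def)
      ultimately show ?thesis
        using tendsto_add by fastforce
    qed
    then show ?thesis
      by (simp add: tendsto_coordinatewise)
  qed
  have f_lim: "(\<lambda>k. f (c (r k)) i) \<longlonglongrightarrow> f t i"
    if "(\<lambda>k. c (r k)) \<longlonglongrightarrow> t" "\<And>k. c k \<in> unit_cube n" for c i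
  proof -
    have "(\<lambda>k. f (c (r k))) \<longlonglongrightarrow> f t"
      using continuous_on_tendsto_compose[OF cont that(1) t] that(2) by simp
    then show ?thesis
      by (simp add: tendsto_coordinatewise)
  qed
  have "f t i = t i" for i
  proof (cases "i < n")
    case True
    have lim_ab: "(\<lambda>k. a (r k) i) \<longlonglongrightarrow> t" "(\<lambda>k. b (r k) i) \<longlonglongrightarrow> t"
      using near_lim[of "\<lambda>k. a k i"] near_lim[of "\<lambda>k. b k i"] near True by auto
    have "t i \<le> f t i"
      using lim_ab(1) f_lim[of "\<lambda>k. a k i" i] ab sgn True
      by (intro LIMSEQ_le[of "\<lambda>k. a (r k) i i" _ "\<lambda>k. f (a (r k) i) i"])
        (auto simp: tendsto_coordinatewise)
    moreover have "f t i \<le> t i"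
      using lim_ab(2) f_lim[of "\<lambda>k. b k i" i] ab sgn True
      by (intro LIMSEQ_le[of "\<lambda>k. f (b (r k) i) i" _ "\<lambda>k. b (r k) i i"])
        (auto simp: tendsto_coordinatewise)
    ultimately show ?thesis
      by simp
  next
    case False
    then show ?thesis
      using f t by (auto simp: unit_cube_def image_subset_iff)
  qed
  then show ?thesis
    using t by auto
qed

section \<open>Fixed points of correspondences with open values and convex inverse values\<close>

lemma continuous_on_scaleR_tvs:
  fixes g :: "'a::topological_space \<Rightarrow> 'e::real_topological_vector"
  assumes "continuous_on S c" "continuous_on S g"
  shows "continuous_on S (\<lambda>t. c t *\<^sub>R g t)"
  unfolding continuous_on_def
proof
  fix t assume t: "t \<in> S"
  have "((\<lambda>t. (c t, g t)) \<longlongrightarrow> (c t, g t)) (at t within S)"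
    using assms t by (auto intro: tendsto_Pair simp: continuous_on_def)
  then have "LIM t (at t within S). (c t, g t) :> nhds (c t) \<times>\<^sub>F nhds (g t)"
    by (simp add: nhds_prod)
  from filterlim_compose[OF tendsto_scaleR_Pair this]
  show "((\<lambda>t. c t *\<^sub>R g t) \<longlongrightarrow> c t *\<^sub>R g t) (at t within S)"
    by simp
qed

text \<open>
  A partition of unity whose members are indexed like the cover, so that sets occurring several
  times need no special care; only positivity, not the closed support, is confined to \<open>G i\<close>.
\<close>

lemma open_cover_weights:
  fixes S :: "'a::metric_space set"
  assumes S: "compact S"
    and G: "\<And>i. i \<in> I \<Longrightarrow> openin (top_of_set S) (G i)" and cover: "S \<subseteq> (\<Union>i\<in>I. G i)"
    and I: "finite I"
  obtains w :: "'i \<Rightarrow> 'a \<Rightarrow> real"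
  where "\<And>i. i \<in> I \<Longrightarrow> continuous_on S (w i)"
    "\<And>i x. i \<in> I \<Longrightarrow> x \<in> S \<Longrightarrow> 0 \<le> w i x"
    "\<And>i x. i \<in> I \<Longrightarrow> x \<in> S \<Longrightarrow> 0 < w i x \<Longrightarrow> x \<in> G i"
    "\<And>x. x \<in> S \<Longrightarrow> (\<Sum>i\<in>I. w i x) = 1"
proof
  \<comment> \<open>The distance to an empty set is \<open>0\<close> by convention, so full members of the cover are set apart.\<close>
  define d :: "'i \<Rightarrow> 'a \<Rightarrow> real"
    where "d i x = (if S \<subseteq> G i then 1 else infdist x (S - G i))" for i x
  have d_cont: "continuous_on S (d i)" for i
    by (cases "S \<subseteq> G i") (auto simp: d_def intro!: continuous_intros)
  have d_nonneg: "0 \<le> d i x" for i x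
    by (simp add: d_def infdist_nonneg)
  have d_pos: "0 < d i x \<longleftrightarrow> x \<in> G i" if "i \<in> I" "x \<in> S" for i x
  proof (cases "S \<subseteq> G i")
    case True
    then show ?thesis
      using that by (auto simp: d_def)
  next
    case False
    have "closed (S - G i)"
      using S G[OF that(1)]
      by (metis closedin_closed_trans closedin_diff closedin_self compact_imp_closed)
    then show ?thesis
      using False that in_closed_iff_infdist_zero[of "S - G i" x] infdist_nonneg[of x "S - G i"]
      by (auto simp: d_def)
  qed
  define w where "w i x = d i x / (\<Sum>j\<in>I. d j x)" for i x
  have sum_pos: "0 < (\<Sum>j\<in>I. d j x)" if x: "x \<in> S" for x
  proof -
    obtain i where "i \<in> I" "x \<in> G i"
      using cover x by blast
    then show ?thesis
      using I d_pos[of i x] x d_nonneg by (auto intro: sum_pos2)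
  qed
  show "continuous_on S (w i)" if "i \<in> I" for i
    unfolding w_def using sum_pos by (intro continuous_intros d_cont) force
  show "0 \<le> w i x" if "i \<in> I" "x \<in> S" for i x
    by (simp add: w_def d_nonneg sum_nonneg)
  show "x \<in> G i" if "i \<in> I" "x \<in> S" "0 < w i x" for i x
    using that sum_pos[of x] d_pos[of i x] by (simp add: w_def zero_less_divide_iff)
  show "(\<Sum>i\<in>I. w i x) = 1" if "x \<in> S" for x
    using sum_pos[OF that] by (simp add: w_def flip: sum_divide_distrib)
qed

text \<open>
  The finite cover takes the place of compactness of \<open>X\<close>; partitions of unity are only needed on
  a cube, whatever the separation properties of the ambient space.
\<close>

theorem fixed_point_finite_cover:
  fixes X :: "'e::real_topological_vector set"
  assumes X: "X \<noteq> {}" "convex X"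
    and M: "finite M" "M \<subseteq> X"
    and F_open: "\<And>x. x \<in> M \<Longrightarrow> openin (top_of_set X) (F x)"
    and cover: "X \<subseteq> (\<Union>x\<in>M. F x)"
    and inv: "\<And>u. u \<in> X \<Longrightarrow> convex (inverse_corr X F u)"
  shows "\<exists>u \<in> X. u \<in> F u"
proof -
  obtain h where h: "bij_betw h {0..<card M} M"
    using ex_bij_betw_nat_finite[OF M(1)] by auto
  define n where "n = card M"
  have h_img: "h ` {..<n} = M"
    using h by (simp add: bij_betw_def n_def atLeast0LessThan)
  then have h_M: "h i \<in> M" if "i < n" for i
    using that by auto
  obtain x0 where x0: "x0 \<in> X"
    using X by auto
  \<comment> \<open>The map \<open>\<phi>\<close> is defined on the whole cube: a coordinate sum above \<open>1\<close> is scaled down to \<open>1\<close>,\<close>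
  \<comment> \<open>and a sum below \<open>1\<close> is completed by weight on the arbitrary point \<open>x0\<close> of \<open>X\<close>.\<close>
  define m where "m t = max 1 (\<Sum>i<n. t i)" for t :: "nat \<Rightarrow> real"
  define \<phi> where "\<phi> t = (\<Sum>i<n. (t i / m t) *\<^sub>R h i) + (1 - (\<Sum>i<n. t i) / m t) *\<^sub>R x0"
    for t :: "nat \<Rightarrow> real"
  have m_pos: "0 < m t" for t
    by (simp add: m_def)
  have coord: "continuous_on S (\<lambda>t::nat \<Rightarrow> real. t i)" for S i
    by (rule continuous_on_subset[OF continuous_on_product_coordinates]) simp
  have m_cont: "continuous_on S m" for S
    unfolding m_def by (intro continuous_intros coord)
  have m_nz: "m t \<noteq> 0" for t
    using m_pos[of t] by simp
  have \<phi>_cont: "continuous_on S \<phi>" for S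
    unfolding \<phi>_def
    by (intro continuous_on_add continuous_on_sum continuous_on_scaleR_tvs
        continuous_on_const continuous_on_diff continuous_on_divide coord m_cont) (simp_all add: m_nz)
  have \<phi>_X: "\<phi> t \<in> X" if t: "t \<in> unit_cube n" for t
  proof -
    define c where "c i = (if i < n then t i / m t else 1 - (\<Sum>i<n. t i) / m t)" for i
    have "(\<Sum>i<n. t i) / m t \<le> 1"
      using m_pos[of t] by (simp add: m_def)
    then have "(\<Sum>i<Suc n. c i *\<^sub>R (if i < n then h i else x0)) \<in> X"
      using t m_pos[of t] h_M M x0
      by (intro convex_sum[OF _ X(2)])
        (auto simp: c_def unit_cube_def sum_divide_distrib)
    then show ?thesis
      by (simp add: c_def \<phi>_def)
  qed
  have "openin (top_of_set (unit_cube n)) (unit_cube n \<inter> \<phi> -` F (h i))" if "i < n" for i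
    using continuous_openin_preimage[OF \<phi>_cont _ F_open[OF h_M[OF that]]] \<phi>_X by auto
  moreover have "unit_cube n \<subseteq> (\<Union>i<n. unit_cube n \<inter> \<phi> -` F (h i))"
    using cover \<phi>_X h_img by fastforce
  ultimately obtain w :: "nat \<Rightarrow> (nat \<Rightarrow> real) \<Rightarrow> real"
    where w_cont: "\<And>i. i < n \<Longrightarrow> continuous_on (unit_cube n) (w i)"
    and w_nonneg: "\<And>i t. i < n \<Longrightarrow> t \<in> unit_cube n \<Longrightarrow> 0 \<le> w i t"
    and w_pos: "\<And>i t. i < n \<Longrightarrow> t \<in> unit_cube n \<Longrightarrow> 0 < w i t \<Longrightarrow> \<phi> t \<in> F (h i)"
    and w_sum: "\<And>t. t \<in> unit_cube n \<Longrightarrow> (\<Sum>i<n. w i t) = 1"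
    by (rule open_cover_weights[OF compact_unit_cube[of n], of "{..<n}"
        "\<lambda>i. unit_cube n \<inter> \<phi> -` F (h i)"]) auto
  define g where "g t = (\<lambda>i. if i < n then w i t else 0)" for t
  have "continuous_on (unit_cube n) g"
    unfolding g_def
  proof (rule continuous_on_coordinatewise_then_product)
    show "continuous_on (unit_cube n) (\<lambda>t. if i < n then w i t else 0)" for i
      using w_cont by (cases "i < n") auto
  qed
  moreover have "g ` unit_cube n \<subseteq> unit_cube n"
  proof clarify
    fix t assume t: "t \<in> unit_cube n"
    have "w i t \<le> 1" if "i < n" for i
      using member_le_sum[of i "{..<n}" "\<lambda>i. w i t"] w_nonneg w_sum t that by simp
    then show "g t \<in> unit_cube n"
      using w_nonneg t by (simp add: g_def unit_cube_def)
  qed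
  ultimately obtain t where t: "t \<in> unit_cube n" and gt: "g t = t"
    using brouwer_unit_cube by blast
  \<comment> \<open>The values of \<open>g\<close> have coordinate sum \<open>1\<close>, so \<open>t\<close> lies in the standard simplex.\<close>
  have t_w: "t i = w i t" if "i < n" for i
    using that fun_cong[OF gt, of i] by (simp add: g_def)
  then have sum1: "(\<Sum>i<n. t i) = 1"
    using w_sum[OF t] by simp
  then have \<phi>t: "\<phi> t = (\<Sum>i<n. t i *\<^sub>R h i)"
    by (simp add: \<phi>_def m_def)
  let ?P = "{i. i < n \<and> 0 < t i}"
  have zero: "t i = 0" if "i \<in> {..<n} - ?P" for i
    using that w_nonneg[OF _ t, of i] t_w[of i] by auto
  have "(\<Sum>i\<in>?P. t i *\<^sub>R h i) \<in> inverse_corr X F (\<phi> t)"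
  proof (rule convex_sum)
    show "convex (inverse_corr X F (\<phi> t))"
      using inv \<phi>_X t by blast
    show "(\<Sum>i\<in>?P. t i) = 1"
      unfolding sum1[symmetric] using zero by (intro sum.mono_neutral_left) auto
    show "h i \<in> inverse_corr X F (\<phi> t)" if "i \<in> ?P" for i
      using that w_pos[OF _ t, of i] t_w[of i] h_M M by (auto simp: inverse_corr_def)
  qed auto
  also have "(\<Sum>i\<in>?P. t i *\<^sub>R h i) = \<phi> t"
    unfolding \<phi>t using zero by (intro sum.mono_neutral_left) auto
  finally show ?thesis
    by (auto simp: inverse_corr_def)
qed

section \<open>The quasi-equilibrium theorem\<close>

theorem theorem4:
  fixes X :: "'e::real_topological_vector set"
    and C :: "'z::{real_topological_vector, t2_space} set"
    and K :: "'e \<Rightarrow> 'e set"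
    and f :: "'e \<Rightarrow> 'e \<Rightarrow> 'z set"
    and A :: "'e set"
  assumes X: "X \<noteq> {}" "compact X" "convex X"
    and C: "pointed_cone C" "closed C" "convex C" "interior C \<noteq> {}"
    and K: "\<And>x. x \<in> X \<Longrightarrow> K x \<subseteq> X" "\<And>x. x \<in> X \<Longrightarrow> K x \<noteq> {}"
    and f: "\<And>x u. x \<in> X \<Longrightarrow> u \<in> X \<Longrightarrow> f x u \<noteq> {}"
    and A: "A = {x \<in> X. \<exists>u \<in> K x. f x u \<subseteq> uminus ` interior C}"
    and i: "\<And>x. x \<in> X \<Longrightarrow> openin (top_of_set X) (K x)"
      "\<And>x. x \<in> X \<Longrightarrow> openin (top_of_set X) {u \<in> X. f x u \<subseteq> uminus ` interior C}"
    and ii: "\<And>x. x \<in> X \<Longrightarrow> \<not> f x x \<subseteq> uminus ` interior C"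
    and iii: "\<exists>M. finite M \<and> M \<noteq> {} \<and> M \<subseteq> X \<and>
      (\<Union>x \<in> M \<inter> A. {u \<in> X. f x u \<subseteq> uminus ` interior C} \<inter> K x) \<union> (\<Union>x \<in> M - A. K x) = X"
    and iv: "\<And>u. u \<in> X \<Longrightarrow> convex (inverse_corr X K u)"
      "\<And>u. u \<in> X \<Longrightarrow> convex ({x \<in> X. f x u \<subseteq> uminus ` interior C} \<union> (X - A))"
  shows "\<exists>x \<in> X. x \<in> K x \<and> (\<forall>y \<in> K x. \<not> f x y \<subseteq> uminus ` interior C)"
proof -
  define P where "P x = {u \<in> X. f x u \<subseteq> uminus ` interior C}" for x
  define F where "F x = (if x \<in> A then P x \<inter> K x else K x)" for x
  obtain M where M: "finite M" "M \<subseteq> X"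
    and cover: "(\<Union>x \<in> M \<inter> A. P x \<inter> K x) \<union> (\<Union>x \<in> M - A. K x) = X"
    using iii unfolding P_def by blast
  have "X \<subseteq> (\<Union>x\<in>M. F x)"
    unfolding cover[symmetric] by (auto simp: F_def)
  moreover have "openin (top_of_set X) (F x)" if "x \<in> M" for x
    using that M i by (auto simp: F_def P_def intro: openin_Int)
  moreover have "convex (inverse_corr X F u)" if u: "u \<in> X" for u
  proof -
    have "inverse_corr X F u =
        inverse_corr X K u \<inter> ({x \<in> X. f x u \<subseteq> uminus ` interior C} \<union> (X - A))"
      using u by (auto simp: inverse_corr_def F_def P_def)
    then show ?thesis
      using convex_Int iv u by metis
  qed
  ultimately obtain u where u: "u \<in> X" "u \<in> F u"
    using fixed_point_finite_cover[OF X(1,3) M] by blast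
  then have "u \<notin> A"
    using ii by (auto simp: F_def P_def)
  then show ?thesis
    using u A by (auto simp: F_def)
qed

end
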